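(* Let $f:\mathbb{R}^{d_x}\times\mathbb{R}^{d_y}\to\mathbb{R}$ be twice continuously differentiable with $\rho$-Lipschitz continuous Hessians, having at least one saddle point, and $\mu$-strongly-convex-$\mu$-strongly-concave for some $\mu>0$; write $\kappa=\rho/\mu$. Let $z^*=(x^*,y^* )$ be the unique saddle point. Set $M=3\rho m$ and $$T=\left(\frac{2M\|z_0-z^*\|}{\mu}\right)^{2/3}.$$ Then the sequence of iterates $z^{(s)}$ generated by LEN-restart$(z_0,T,m,M,S)$ converges to $z^*$ superlinearly: $$\|z^{(s)}-z^*\|^2\le\left(\tfrac12\right)^{(3/2)^{s}}\|z_0-z^*\|^2.$$ In other words, LEN-restart finds a point $z^{(s)}$ such that $\|z^{(s)}-z^*\|\le\epsilon$ within $S=\log_{3/2}\log_2(1/\epsilon)$ epochs. The total number of inner loop iterations is given by $$TS=\mathcal{O}\big(m^{2/3}\kappa^{2/3}\log\log(1/\epsilon)\big).$$ If computing $F(\cdot)$ is counted with computational complexity $N$ and computing $\nabla F(\cdot)$ with computational complexity $Nd$, then LEN-restart with $m=\Theta(d)$ takes the computational complexity of $\mathcal{O}\big((Nd+Nd^{2/3}\kappa^{2/3})\log\log(1/\epsilon)\big)$ to call the oracles $F(\cdot)$ and $\nabla F(\cdot)$.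
   Context: Notation: $d=d_x+d_y$, $z=(x,y)\in\mathbb{R}^d$, $\|\cdot\|$ is the Euclidean norm (spectral norm for matrices), $m$ is a positive integer. $f$ has $\rho$-Lipschitz continuous Hessians if $\|\nabla^2 f(x,y)-\nabla^2 f(x',y')\|\le\rho\|(x,y)-(x',y')\|$ for all points. $f$ is $\mu$-strongly-convex-$\mu$-strongly-concave if for all $x,x',y,y'$: $f(x',y)\ge f(x,y)+\langle x'-x,\nabla_x f(x,y)\rangle+\frac{\mu}{2}\|x-x'\|^2$ and $f(x,y')\le f(x,y)+\langle y'-y,\nabla_y f(x,y)\rangle-\frac{\mu}{2}\|y-y'\|^2$. A saddle point is $(x^*,y^* )$ with $f(x^*,y)\le f(x^*,y^* )\le f(x,y^* )$ for all $x,y$. Let $F(z)=\begin{bmatrix}\nabla_x f(x,y)\\ -\nabla_y f(x,y)\end{bmatrix}$ and let $\nabla F(z)$ be its Jacobian. Algorithm LEN$(z_0,T,m,M)$: let $\pi(t)=t-(t\bmod m)$. For $t=0,\dots,T-1$: (i) find $z_{t+1/2}$ that satisfies $F(z_t)=\big(\nabla F(z_{\pi(t)})+M\|z_t-z_{t+1/2}\| I_d\big)(z_t-z_{t+1/2})$; (ii) compute $\gamma_t=M\|z_t-z_{t+1/2}\|$; (iii) compute $z_{t+1}=z_t-\gamma_t^{-1}F(z_{t+1/2})$. Return $\bar z_T=\big(\sum_{t=0}^{T-1}\gamma_t^{-1}\big)^{-1}\sum_{t=0}^{T-1}\gamma_t^{-1}z_{t+1/2}$. Algorithm LEN-restart$(z_0,T,m,M,S)$: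 set $z^{(0)}=z_0$; for $s=0,\dots,S-1$ set $z^{(s+1)}=\mathrm{LEN}(z^{(s)},T,m,M)$ (each such call is an epoch).
   Formalization: The bound is for s≥1 (false at s=0); ρ>0; T and S are rounded up; ε-accuracy is for ε<1/2 and ‖z0−z*‖≤max(1,1/(4ε)), as S ignores ‖z0−z*‖; O-constants depend on ‖z0−z*‖ and, for TS, on a positive lower bound of κ, since T≥1. *)

theory Defs
  imports "HOL-Analysis.Analysis" "HOL-Library.Landau_Symbols"
begin

definition grad :: "('a::euclidean_space \<Rightarrow> real) \<Rightarrow> 'a \<Rightarrow> 'a" where
  "grad f z = (THE D. GDERIV f z :> D)"

text \<open>The Hessian is the linear map \<open>h \<mapsto> (\<nabla>\<^sup>2 f z) h\<close>, the derivative of the gradient;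
  its spectral norm is the operator norm \<^const>\<open>onorm\<close>.\<close>

definition hessian :: "('a::euclidean_space \<Rightarrow> real) \<Rightarrow> 'a \<Rightarrow> 'a \<Rightarrow> 'a" where
  "hessian f z = frechet_derivative (grad f) (at z)"

definition twice_cont_diff :: "('a::euclidean_space \<Rightarrow> real) \<Rightarrow> bool" where
  "twice_cont_diff f \<longleftrightarrow>
     (\<forall>z. f differentiable (at z)) \<and> (\<forall>z. grad f differentiable (at z)) \<and>
     (\<forall>h. continuous_on UNIV (\<lambda>z. hessian f z h))"

definition lipschitz_hessian :: "real \<Rightarrow> ('a::euclidean_space \<Rightarrow> real) \<Rightarrow> bool" where
  "lipschitz_hessian \<rho> f \<longleftrightarrow>
     (\<forall>z z'. onorm (\<lambda>h. hessian f z h - hessian f z' h) \<le> \<rho> * norm (z - z'))"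

definition grad_x :: "('a::euclidean_space \<times> 'b::euclidean_space \<Rightarrow> real) \<Rightarrow> 'a \<times> 'b \<Rightarrow> 'a" where
  "grad_x f z = grad (\<lambda>x. f (x, snd z)) (fst z)"

definition grad_y :: "('a::euclidean_space \<times> 'b::euclidean_space \<Rightarrow> real) \<Rightarrow> 'a \<times> 'b \<Rightarrow> 'b" where
  "grad_y f z = grad (\<lambda>y. f (fst z, y)) (snd z)"

definition strongly_convex_concave ::
    "real \<Rightarrow> ('a::euclidean_space \<times> 'b::euclidean_space \<Rightarrow> real) \<Rightarrow> bool" where
  "strongly_convex_concave \<mu> f \<longleftrightarrow>
     (\<forall>x x' y y'.
        f (x', y) \<ge> f (x, y) + inner (x' - x) (grad_x f (x, y)) + \<mu> / 2 * (norm (x - x'))\<^sup>2 \<and>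
        f (x, y') \<le> f (x, y) + inner (y' - y) (grad_y f (x, y)) - \<mu> / 2 * (norm (y - y'))\<^sup>2)"

definition saddle_point :: "('a \<times> 'b \<Rightarrow> real) \<Rightarrow> 'a \<times> 'b \<Rightarrow> bool" where
  "saddle_point f z \<longleftrightarrow>
     (\<forall>x y. f (fst z, y) \<le> f (fst z, snd z) \<and> f (fst z, snd z) \<le> f (x, snd z))"

definition saddle_op ::
    "('a::euclidean_space \<times> 'b::euclidean_space \<Rightarrow> real) \<Rightarrow> 'a \<times> 'b \<Rightarrow> 'a \<times> 'b" where
  "saddle_op f z = (grad_x f z, - grad_y f z)"

definition jacobian :: "('a::euclidean_space \<Rightarrow> 'a) \<Rightarrow> 'a \<Rightarrow> 'a \<Rightarrow> 'a" where
  "jacobian F z = frechet_derivative F (at z)"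

definition snapshot :: "nat \<Rightarrow> nat \<Rightarrow> nat" where
  "snapshot m t = t - t mod m"

text \<open>
  \<open>LEN F z0 T m M out\<close>: \<open>out\<close> is a possible output of the algorithm. The algorithm only asks to
  ``find'' a half-step point \<open>w t\<close> (which is \<open>z\<close> at index \<open>t + 1/2\<close>), hence a relation.

  The iteration divides by \<open>\<gamma>\<close>. If \<open>\<gamma> t = 0\<close>, then \<open>w t = z t\<close> and the half-step equation says
  \<open>F (z t) = 0\<close>; the method then returns \<open>z t\<close> (for \<open>\<gamma> t\<close> tending to \<open>0\<close> all the weight of the
  average sits on \<open>w t = z t\<close>). Since \<open>inverse 0 = 0\<close>, the sequence \<open>z\<close> is formally constant
  for one step there. The empty run \<open>T = 0\<close> returns its starting point.
\<close>

definition LEN ::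
    "('a::euclidean_space \<Rightarrow> 'a) \<Rightarrow> 'a \<Rightarrow> nat \<Rightarrow> nat \<Rightarrow> real \<Rightarrow> 'a \<Rightarrow> bool" where
  "LEN F z0 T m M out \<longleftrightarrow>
     (\<exists>(z :: nat \<Rightarrow> 'a) (w :: nat \<Rightarrow> 'a) (\<gamma> :: nat \<Rightarrow> real).
        z 0 = z0 \<and>
        (\<forall>t<T.
           F (z t) = jacobian F (z (snapshot m t)) (z t - w t)
                     + (M * norm (z t - w t)) *\<^sub>R (z t - w t) \<and>
           \<gamma> t = M * norm (z t - w t) \<and>
           z (Suc t) = z t - inverse (\<gamma> t) *\<^sub>R F (w t)) \<and>
        (if T = 0 then out = z0
         else if \<exists>t<T. \<gamma> t = 0 then \<exists>t<T. \<gamma> t = 0 \<and> out = z t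
         else out = inverse (\<Sum>t<T. inverse (\<gamma> t)) *\<^sub>R (\<Sum>t<T. inverse (\<gamma> t) *\<^sub>R w t)))"

definition LEN_restart ::
    "('a::euclidean_space \<Rightarrow> 'a) \<Rightarrow> 'a \<Rightarrow> nat \<Rightarrow> nat \<Rightarrow> real \<Rightarrow> nat \<Rightarrow> (nat \<Rightarrow> 'a) \<Rightarrow> bool" where
  "LEN_restart F z0 T m M S Z \<longleftrightarrow> Z 0 = z0 \<and> (\<forall>s<S. LEN F (Z s) T m M (Z (Suc s)))"

text \<open>Iteration counts are integers, so the real-valued formulas are rounded up.
  In \<open>epoch_length \<rho> \<mu> m D\<close>, \<open>D\<close> is the initial distance to the saddle point.\<close>

definition epoch_length :: "real \<Rightarrow> real \<Rightarrow> nat \<Rightarrow> real \<Rightarrow> nat" where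
  "epoch_length \<rho> \<mu> m D = nat \<lceil>(2 * (3 * \<rho> * real m) * D / \<mu>) powr (2 / 3)\<rceil>"

definition num_epochs :: "real \<Rightarrow> nat" where
  "num_epochs \<epsilon> = nat \<lceil>log (3 / 2) (log 2 (1 / \<epsilon>))\<rceil>"

text \<open>Oracle calls in one epoch: \<open>F\<close> is evaluated at \<open>z t\<close> and at \<open>w t\<close> in each inner iteration, and
  its Jacobian once at each snapshot point. A run stopped early because of \<open>\<gamma> t = 0\<close> makes no more
  calls than this.\<close>

definition F_calls :: "nat \<Rightarrow> nat" where
  "F_calls T = 2 * T"

definition jacobian_calls :: "nat \<Rightarrow> nat \<Rightarrow> nat" where
  "jacobian_calls m T = card (snapshot m ` {..<T})"

definition oracle_cost :: "real \<Rightarrow> nat \<Rightarrow> nat \<Rightarrow> nat \<Rightarrow> nat \<Rightarrow> real" where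
  "oracle_cost N d m T S =
     real S * (N * real (F_calls T) + N * real d * real (jacobian_calls m T))"

end

theory Submission
  imports Defs "HOL-Real_Asymp.Real_Asymp"
begin

text \<open>
  The operator \<open>F\<close> is strongly monotone around the saddle point \<open>z*\<close>. Write \<open>r\<close> for the length of a
  half step and \<open>q\<close> for the distance from the half-step point to the next iterate. By Taylor's formula
  \<open>q\<close> is at most \<open>(r / 2 + D) / (3 m)\<close>, where \<open>D\<close> is the distance of the current iterate to its
  snapshot; since \<open>D\<close> is a sum of fewer than \<open>m\<close> steps, summation gives \<open>\<Sum> q\<^sup>2 \<le> 5/14 \<Sum> r\<^sup>2\<close>.
  The extragradient identity then bounds a weighted combination of \<open>\<mu> \<Sum> \<gamma>\<^sup>-\<^sup>1 \<parallel>w - z*\<parallel>\<^sup>2\<close> and \<open>\<Sum> r\<^sup>2\<close> by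
  half the squared initial distance. As \<open>\<gamma>\<close> is proportional to \<open>r\<close>, Hoelder's inequality bounds
  \<open>\<Sum> \<gamma>\<^sup>-\<^sup>1\<close> from below by \<open>T\<^sup>3\<^sup>/\<^sup>2 (\<Sum> r\<^sup>2)\<^sup>-\<^sup>1\<^sup>/\<^sup>2 / M\<close>, and the choice of \<open>T\<close> turns this into
  \<open>8 R\<^sub>0 R\<^sub>s\<^sub>+\<^sub>1\<^sup>2 \<le> R\<^sub>s\<^sup>3\<close> for the distances \<open>R\<^sub>s\<close> of the restarts to \<open>z*\<close>.
\<close>

section \<open>Gradients and the saddle operator\<close>

lemma GDERIV_unique:
  assumes "GDERIV f z :> D" "GDERIV f z :> E"
  shows "D = E"
proof -
  have "(\<lambda>h. inner h D) = (\<lambda>h. inner h E)"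
    using assms unfolding gderiv_def by (rule has_derivative_unique)
  then show ?thesis
    by (metis vector_eq_ldot)
qed

lemma grad_eqI: "GDERIV f z :> D \<Longrightarrow> grad f z = D"
  unfolding grad_def by (blast intro: the_equality GDERIV_unique)

lemma GDERIV_grad:
  assumes "f differentiable (at z)"
  shows "GDERIV f z :> grad f z"
proof -
  obtain f' where f': "(f has_derivative f') (at z)"
    using assms by (auto simp: differentiable_def)
  then have "linear f'"
    by (rule has_derivative_linear)
  \<comment> \<open>The Riesz representative of the functional \<open>f'\<close> is its adjoint
    applied to 1.\<close>
  then have "f' = (\<lambda>h. inner h (adjoint f' 1))"
    by (simp add: adjoint_works)
  with f' have "GDERIV f z :> adjoint f' 1"
    by (simp add: gderiv_def)
  then show ?thesis
    using grad_eqI by metis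
qed

lemma GDERIV_partial_x:
  assumes "f differentiable (at z)"
  shows "GDERIV (\<lambda>x. f (x, snd z)) (fst z) :> fst (grad f z)"
proof -
  have "(f has_derivative (\<lambda>h. inner h (grad f z))) (at (fst z, snd z))"
    using GDERIV_grad[OF assms] by (simp add: gderiv_def)
  moreover have "((\<lambda>x. (x, snd z)) has_derivative (\<lambda>h. (h, 0))) (at (fst z))"
    by (auto intro!: derivative_eq_intros)
  ultimately have "((\<lambda>x. f (x, snd z)) has_derivative (\<lambda>h. inner (h, 0) (grad f z))) (at (fst z))"
    using has_derivative_compose by fastforce
  then show ?thesis
    by (simp add: gderiv_def inner_prod_def)
qed

lemma grad_x_eq:
  assumes "f differentiable (at z)"
  shows "grad_x f z = fst (grad f z)"
  unfolding grad_x_def using GDERIV_partial_x[OF assms] by (rule grad_eqI)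

lemma GDERIV_partial_y:
  assumes "f differentiable (at z)"
  shows "GDERIV (\<lambda>y. f (fst z, y)) (snd z) :> snd (grad f z)"
proof -
  have "(f has_derivative (\<lambda>h. inner h (grad f z))) (at (fst z, snd z))"
    using GDERIV_grad[OF assms] by (simp add: gderiv_def)
  moreover have "((\<lambda>y. (fst z, y)) has_derivative (\<lambda>h. (0, h))) (at (snd z))"
    by (auto intro!: derivative_eq_intros)
  ultimately have "((\<lambda>y. f (fst z, y)) has_derivative (\<lambda>h. inner (0, h) (grad f z))) (at (snd z))"
    using has_derivative_compose by fastforce
  then show ?thesis
    by (simp add: gderiv_def inner_prod_def)
qed

lemma grad_y_eq:
  assumes "f differentiable (at z)"
  shows "grad_y f z = snd (grad f z)"
  unfolding grad_y_def using GDERIV_partial_y[OF assms] by (rule grad_eqI)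

lemma has_derivative_grad:
  assumes "twice_cont_diff f"
  shows "(grad f has_derivative hessian f z) (at z)"
proof -
  have "grad f differentiable (at z)"
    using assms by (simp only: twice_cont_diff_def)
  then show ?thesis
    by (simp add: hessian_def frechet_derivative_works)
qed

lemma has_derivative_saddle_op:
  assumes "twice_cont_diff f"
  shows "(saddle_op f has_derivative (\<lambda>h. (fst (hessian f z h), - snd (hessian f z h)))) (at z)"
proof -
  have "saddle_op f = (\<lambda>z. (fst (grad f z), - snd (grad f z)))"
    using assms by (auto simp: saddle_op_def twice_cont_diff_def grad_x_eq grad_y_eq)
  with has_derivative_grad[OF assms, of z] show ?thesis
    by (auto intro!: derivative_eq_intros)
qed

lemma jacobian_saddle_op:
  assumes "twice_cont_diff f"
  shows "jacobian (saddle_op f) z = (\<lambda>h. (fst (hessian f z h), - snd (hessian f z h)))"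
  unfolding jacobian_def
  using frechet_derivative_at[OF has_derivative_saddle_op[OF assms]] by simp

text \<open>Changing the sign of the second component is an isometry, so the saddle operator
  inherits the Lipschitz constant of the Hessian.\<close>

lemma jacobian_saddle_op_lipschitz:
  assumes "twice_cont_diff f" "lipschitz_hessian \<rho> f"
  shows "norm (jacobian (saddle_op f) z h - jacobian (saddle_op f) z' h) \<le> \<rho> * norm (z - z') * norm h"
proof -
  let ?H = "\<lambda>h. hessian f z h - hessian f z' h"
  have "bounded_linear (hessian f u)" for u
    using has_derivative_grad[OF assms(1)] by (rule has_derivative_bounded_linear)
  then have "norm (?H h) \<le> onorm ?H * norm h"
    by (intro onorm bounded_linear_sub)
  also have "\<dots> \<le> \<rho> * norm (z - z') * norm h"
    using assms(2) by (intro mult_right_mono) (simp_all add: lipschitz_hessian_def del: split_paired_All)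
  also have "norm (?H h) = norm (jacobian (saddle_op f) z h - jacobian (saddle_op f) z' h)"
    by (simp add: jacobian_saddle_op[OF assms(1)] norm_prod_def norm_minus_commute)
  finally show ?thesis .
qed

text \<open>Each restricted function has an extremum at \<open>zs\<close>, so both partial gradients
  vanish there, and strong convexity and strong concavity expanded at \<open>zs\<close> keep only
  their quadratic terms.\<close>

lemma saddle_gap_growth:
  assumes "\<And>z. f differentiable (at z)" "strongly_convex_concave \<mu> f" "saddle_point f zs"
  shows "f (fst w, snd zs) - f (fst zs, snd w) \<ge> \<mu> / 2 * (norm (w - zs))\<^sup>2"
proof -
  have "GDERIV (\<lambda>x. f (x, snd zs)) (fst zs) :> grad_x f zs"
    using GDERIV_partial_x[OF assms(1), of zs] by (simp add: grad_x_eq assms(1))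
  then have "(\<lambda>h. inner h (grad_x f zs)) = (\<lambda>h. 0)"
    using assms(3) unfolding gderiv_def
    by (intro differential_zero_maxmin[of _ UNIV "\<lambda>x. f (x, snd zs)"]) (auto simp: saddle_point_def)
  then have gx: "grad_x f zs = 0"
    by (metis inner_eq_zero_iff)
  have "GDERIV (\<lambda>y. f (fst zs, y)) (snd zs) :> grad_y f zs"
    using GDERIV_partial_y[OF assms(1), of zs] by (simp add: grad_y_eq assms(1))
  then have "(\<lambda>h. inner h (grad_y f zs)) = (\<lambda>h. 0)"
    using assms(3) unfolding gderiv_def
    by (intro differential_zero_maxmin[of _ UNIV "\<lambda>y. f (fst zs, y)"]) (auto simp: saddle_point_def)
  then have gy: "grad_y f zs = 0"
    by (metis inner_eq_zero_iff)
  have "f (fst w, snd zs) \<ge> f zs + \<mu> / 2 * (norm (fst zs - fst w))\<^sup>2"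
    using assms(2) gx unfolding strongly_convex_concave_def
    by (metis inner_zero_right add.right_neutral prod.collapse)
  moreover have "f (fst zs, snd w) \<le> f zs - \<mu> / 2 * (norm (snd zs - snd w))\<^sup>2"
    using assms(2) gy unfolding strongly_convex_concave_def
    by (metis inner_zero_right add.right_neutral prod.collapse)
  moreover have "(norm (w - zs))\<^sup>2 = (norm (fst zs - fst w))\<^sup>2 + (norm (snd zs - snd w))\<^sup>2"
    by (simp add: norm_prod_def norm_minus_commute)
  ultimately show ?thesis
    by (simp add: algebra_simps)
qed

text \<open>Expanding at \<open>w\<close> toward \<open>zs\<close> in each variable bounds the inner
  product from below by the gap plus half of the quadratic term; \<open>saddle_gap_growth\<close>
  supplies the other half.\<close>

lemma saddle_op_strongly_monotone:
  assumes "\<And>z. f differentiable (at z)" "strongly_convex_concave \<mu> f" "saddle_point f zs"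
  shows "\<mu> * (norm (w - zs))\<^sup>2 \<le> inner (saddle_op f w) (w - zs)"
proof -
  have "f (fst zs, snd w) \<ge> f w + inner (fst zs - fst w) (grad_x f w)
      + \<mu> / 2 * (norm (fst w - fst zs))\<^sup>2"
    using assms(2) unfolding strongly_convex_concave_def by (metis prod.collapse)
  moreover have "f (fst w, snd zs) \<le> f w + inner (snd zs - snd w) (grad_y f w)
      - \<mu> / 2 * (norm (snd w - snd zs))\<^sup>2"
    using assms(2) unfolding strongly_convex_concave_def by (metis prod.collapse)
  moreover have "(norm (w - zs))\<^sup>2 = (norm (fst w - fst zs))\<^sup>2 + (norm (snd w - snd zs))\<^sup>2"
    by (simp add: norm_prod_def)
  moreover have "inner (saddle_op f w) (w - zs)
      = inner (snd zs - snd w) (grad_y f w) - inner (fst zs - fst w) (grad_x f w)"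
    by (simp add: saddle_op_def inner_prod_def inner_diff_left inner_diff_right inner_commute)
  ultimately show ?thesis
    using saddle_gap_growth[OF assms, of w] by (simp add: algebra_simps)
qed

lemma saddle_point_unique:
  assumes "\<And>z. f differentiable (at z)" "strongly_convex_concave \<mu> f" "\<mu> > 0"
    and "saddle_point f z" "saddle_point f zs"
  shows "z = zs"
proof -
  have "f (fst z, snd zs) \<le> f (fst zs, snd z)"
    using assms(4) unfolding saddle_point_def by (meson order_trans)
  then have "\<mu> / 2 * (norm (z - zs))\<^sup>2 \<le> 0"
    using saddle_gap_growth[OF assms(1,2,5), of z] by simp
  then show ?thesis
    using assms(3) by (simp add: mult_le_0_iff)
qed

section \<open>One epoch of the lazy method\<close>

text \<open>The mean value inequality is applied along the segment from \<open>z\<close> to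
  \<open>w\<close> after subtracting the linear part. At parameter \<open>s\<close> the remaining
  derivative is at most \<rho> s times the squared length, and integrating \<open>s\<close> over
  [0,1] yields the factor 1/2.\<close>

lemma taylor_lipschitz_derivative:
  fixes F :: "'a::real_normed_vector \<Rightarrow> 'b::real_normed_vector"
  assumes F': "\<And>z. (F has_derivative F' z) (at z)"
    and lip: "\<And>z z' h. norm (F' z h - F' z' h) \<le> \<rho> * norm (z - z') * norm h"
  shows "norm (F w - F z - F' z (w - z)) \<le> \<rho> / 2 * (norm (w - z))\<^sup>2"
proof -
  define g where "g s = F (z + s *\<^sub>R (w - z)) - s *\<^sub>R F' z (w - z)" for s :: real
  define g' where "g' s = F' (z + s *\<^sub>R (w - z)) (w - z) - F' z (w - z)" for s :: real
  have g: "(g has_vector_derivative g' s) (at s)" for s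
  proof -
    have "((\<lambda>s. z + s *\<^sub>R (w - z)) has_derivative (\<lambda>h. h *\<^sub>R (w - z))) (at s)"
      by (auto intro!: derivative_eq_intros)
    from has_derivative_compose[OF this F']
    have "((\<lambda>s. F (z + s *\<^sub>R (w - z))) has_derivative (\<lambda>h. F' (z + s *\<^sub>R (w - z)) (h *\<^sub>R (w - z)))) (at s)" .
    moreover have "linear (F' (z + s *\<^sub>R (w - z)))"
      using F' by (rule has_derivative_linear)
    ultimately have "((\<lambda>s. F (z + s *\<^sub>R (w - z))) has_vector_derivative F' (z + s *\<^sub>R (w - z)) (w - z)) (at s)"
      by (simp add: has_vector_derivative_def linear_cmul)
    then show ?thesis
      unfolding g_def g'_def by (auto intro!: derivative_eq_intros)
  qed
  have "norm (g 1 - g 0) \<le> \<rho> / 2 * (norm (w - z))\<^sup>2 * 1\<^sup>2 - \<rho> / 2 * (norm (w - z))\<^sup>2 * 0\<^sup>2"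
  proof (rule differentiable_bound_general[where f' = g' and \<phi>' = "\<lambda>s. \<rho> * (norm (w - z))\<^sup>2 * s"])
    show "continuous_on {0..1} g"
      using g by (meson continuous_on_vector_derivative has_vector_derivative_at_within)
    show "((\<lambda>s. \<rho> / 2 * (norm (w - z))\<^sup>2 * s\<^sup>2) has_vector_derivative \<rho> * (norm (w - z))\<^sup>2 * s) (at s)" for s
      by (auto intro!: derivative_eq_intros simp flip: has_real_derivative_iff_has_vector_derivative)
    fix s :: real assume "0 < s"
    then show "norm (g' s) \<le> \<rho> * (norm (w - z))\<^sup>2 * s"
      using lip[of "z + s *\<^sub>R (w - z)" "w - z" z] by (simp add: g'_def power2_eq_square mult_ac)
  qed (auto intro!: g continuous_intros)
  then show ?thesis
    by (simp add: g_def algebra_simps)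
qed

text \<open>Induction on \<open>T\<close> needs the potential: \<open>P T\<close> will still be counted with weights
  \<open>T mod m, \<dots>, m - 1\<close> before it is reset.\<close>

lemma sum_mod_weighted_le:
  fixes s P :: "nat \<Rightarrow> real"
  assumes "m > 0" and s: "\<And>t. s t \<ge> 0" and P0: "P 0 = 0"
    and PS: "\<And>t. P (Suc t) = (if Suc t mod m = 0 then 0 else P t + s t)"
  shows "(\<Sum>t<T. real (t mod m) * P t) \<le> (real m)\<^sup>2 / 2 * (\<Sum>t<T. s t)"
proof -
  have P: "P t \<ge> 0" for t
    by (induction t) (simp_all add: P0 PS s)
  \<comment> \<open>With j = \<open>T mod m\<close>, the weights j, ..., m - 1 add up to (m (m - 1)
    - j (j - 1)) / 2. Enlarging m (m - 1) to m^2 gives \<open>c\<close>, which still drops by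
    exactly j from one step to the next inside a block.\<close>
  define c where "c T = ((real m)\<^sup>2 - real (T mod m) * (real (T mod m) - 1)) / 2" for T
  have c_ge: "c T \<ge> real (T mod m)" for T
  proof -
    have "real (T mod m) + 1 \<le> real m"
      using \<open>m > 0\<close> by (metis Suc_leI add.commute mod_less_divisor of_nat_Suc of_nat_le_iff)
    then have "real (T mod m) * (real (T mod m) + 1) \<le> real m * real m"
      by (intro mult_mono) auto
    then show ?thesis
      by (simp add: c_def field_simps power2_eq_square)
  qed
  have "(\<Sum>t<T. real (t mod m) * P t) + c T * P T \<le> (real m)\<^sup>2 / 2 * (\<Sum>t<T. s t)"
  proof (induction T)
    case 0
    show ?case by (simp add: P0)
  next
    case (Suc T)
    show ?case
    proof (cases "Suc T mod m = 0")
      case True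
      have "real (T mod m) * P T \<le> c T * P T"
        using c_ge P by (intro mult_right_mono) auto
      moreover have "0 \<le> (real m)\<^sup>2 / 2 * s T"
        using s by simp
      ultimately show ?thesis
        using Suc True by (simp add: PS distrib_left)
    next
      case False
      then have c: "real (Suc T mod m) = real (T mod m) + 1"
        by (simp add: mod_Suc split: if_splits)
      have "real (T mod m) * P T + c (Suc T) * (P T + s T)
          = c T * P T + (real m)\<^sup>2 / 2 * s T - real (T mod m) * (real (T mod m) + 1) / 2 * s T"
        unfolding c_def c by (simp add: field_simps power2_eq_square)
      also have "\<dots> \<le> c T * P T + (real m)\<^sup>2 / 2 * s T"
        using s by simp
      finally show ?thesis
        using Suc False by (simp add: PS distrib_left)
    qed
  qed
  moreover have "0 \<le> c T * P T"
    using c_ge[of T] P[of T] by (intro mult_nonneg_nonneg) linarith+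
  ultimately show ?thesis
    by linarith
qed

text \<open>The displacement since the snapshot is a sum of \<open>t mod m\<close> steps, so
  Cauchy-Schwarz costs a factor \<open>t mod m\<close>. The sum of the squared steps since the
  snapshot resets at multiples of \<open>m\<close>, as \<open>sum_mod_weighted_le\<close>
  requires.\<close>

lemma sum_snapshot_dist_le:
  fixes z :: "nat \<Rightarrow> 'a::real_normed_vector"
  assumes "m > 0"
  shows "(\<Sum>t<T. (norm (z t - z (snapshot m t)))\<^sup>2)
      \<le> (real m)\<^sup>2 / 2 * (\<Sum>t<T. (norm (z (Suc t) - z t))\<^sup>2)"
proof -
  define P where "P t = (\<Sum>i\<in>{snapshot m t..<t}. (norm (z (Suc i) - z i))\<^sup>2)" for t
  have "(norm (z t - z (snapshot m t)))\<^sup>2 \<le> real (t mod m) * P t" for t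
  proof -
    have le: "snapshot m t \<le> t" and card: "t - snapshot m t = t mod m"
      by (auto simp: snapshot_def)
    have "norm (z t - z (snapshot m t)) = norm (\<Sum>i\<in>{snapshot m t..<t}. z (Suc i) - z i)"
      using le by (simp add: sum_Suc_diff')
    also have "\<dots> \<le> (\<Sum>i\<in>{snapshot m t..<t}. norm (z (Suc i) - z i))"
      by (rule norm_sum)
    finally have "(norm (z t - z (snapshot m t)))\<^sup>2
        \<le> (\<Sum>i\<in>{snapshot m t..<t}. norm (z (Suc i) - z i))\<^sup>2"
      by (intro power_mono) auto
    also have "\<dots> \<le> real (t mod m) * P t"
      using sum_squared_le_sum_of_squares[of "\<lambda>i. norm (z (Suc i) - z i)" "{snapshot m t..<t}"]
      by (simp add: P_def card mult.commute)
    finally show ?thesis .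
  qed
  then have "(\<Sum>t<T. (norm (z t - z (snapshot m t)))\<^sup>2) \<le> (\<Sum>t<T. real (t mod m) * P t)"
    by (intro sum_mono)
  also have "\<dots> \<le> (real m)\<^sup>2 / 2 * (\<Sum>t<T. (norm (z (Suc t) - z t))\<^sup>2)"
  proof (rule sum_mod_weighted_le[OF assms])
    fix t
    show "P (Suc t) = (if Suc t mod m = 0 then 0 else P t + (norm (z (Suc t) - z t))\<^sup>2)"
    proof (cases "Suc t mod m = 0")
      case False
      then have "snapshot m (Suc t) = snapshot m t"
        by (simp add: snapshot_def mod_Suc split: if_splits)
      moreover have "snapshot m t \<le> t"
        by (simp add: snapshot_def)
      ultimately show ?thesis
        using False by (simp add: P_def)
    qed (simp add: P_def snapshot_def)
  qed (auto simp: P_def snapshot_def)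
  finally show ?thesis .
qed

text \<open>Hoelder's inequality with exponents \<open>3/2\<close> and \<open>3\<close>, from two applications of Cauchy-Schwarz.\<close>

lemma card_cubed_le_sum_inverse:
  fixes r :: "nat \<Rightarrow> real"
  assumes "\<And>t. t < T \<Longrightarrow> r t > 0"
  shows "(real T)^3 \<le> (\<Sum>t<T. inverse (r t))\<^sup>2 * (\<Sum>t<T. (r t)\<^sup>2)"
proof (cases "T = 0")
  case False
  have "(\<Sum>t<T. sqrt (inverse (r t)) * sqrt (r t))\<^sup>2
      \<le> (\<Sum>t<T. (sqrt (inverse (r t)))\<^sup>2) * (\<Sum>t<T. (sqrt (r t))\<^sup>2)"
    by (rule Cauchy_Schwarz_ineq_sum)
  moreover have "sqrt (inverse (r t)) * sqrt (r t) = 1" "(sqrt (inverse (r t)))\<^sup>2 = inverse (r t)"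
    "(sqrt (r t))\<^sup>2 = r t" if "t < T" for t
    using assms[OF that] by (simp_all flip: real_sqrt_mult)
  ultimately have "(real T)\<^sup>2 \<le> (\<Sum>t<T. inverse (r t)) * (\<Sum>t<T. r t)"
    by simp
  then have "((real T)\<^sup>2)\<^sup>2 \<le> (\<Sum>t<T. inverse (r t))\<^sup>2 * (\<Sum>t<T. r t)\<^sup>2"
    by (metis power_mono power_mult_distrib zero_le_power2)
  also have "\<dots> \<le> (\<Sum>t<T. inverse (r t))\<^sup>2 * ((\<Sum>t<T. (r t)\<^sup>2) * real T)"
    using sum_squared_le_sum_of_squares[of r "{..<T}"]
    by (intro mult_left_mono) (auto simp: mult.commute)
  finally have "real T * (real T)^3 \<le> real T * ((\<Sum>t<T. inverse (r t))\<^sup>2 * (\<Sum>t<T. (r t)\<^sup>2))"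
    by (simp add: eval_nat_numeral mult_ac)
  then show ?thesis
    using False by (simp only: mult_le_cancel_left_pos of_nat_0_less_iff neq0_conv)
qed simp

text \<open>Jensen's inequality for the squared norm, from the triangle inequality and
  Cauchy-Schwarz with each weight split into two square roots.\<close>

lemma norm_weighted_mean_diff_le:
  fixes w :: "nat \<Rightarrow> 'a::real_normed_vector"
  assumes "\<And>t. t < T \<Longrightarrow> \<eta> t \<ge> 0" "(\<Sum>t<T. \<eta> t) > 0"
  shows "(\<Sum>t<T. \<eta> t) * (norm (inverse (\<Sum>t<T. \<eta> t) *\<^sub>R (\<Sum>t<T. \<eta> t *\<^sub>R w t) - c))\<^sup>2
    \<le> (\<Sum>t<T. \<eta> t * (norm (w t - c))\<^sup>2)"
proof -
  let ?H = "\<Sum>t<T. \<eta> t" and ?v = "inverse (\<Sum>t<T. \<eta> t) *\<^sub>R (\<Sum>t<T. \<eta> t *\<^sub>R w t) - c"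
  have "?H *\<^sub>R ?v = (\<Sum>t<T. \<eta> t *\<^sub>R (w t - c))"
    using assms(2) by (simp add: scaleR_diff_right sum_subtractf scaleR_sum_left)
  then have "?H * norm ?v = norm (\<Sum>t<T. \<eta> t *\<^sub>R (w t - c))"
    using assms(2) by (metis abs_of_pos norm_scaleR)
  also have "\<dots> \<le> (\<Sum>t<T. sqrt (\<eta> t) * (sqrt (\<eta> t) * norm (w t - c)))"
    using assms(1) by (intro sum_norm_le) (simp flip: mult.assoc)
  finally have "(?H * norm ?v)\<^sup>2 \<le> (\<Sum>t<T. sqrt (\<eta> t) * (sqrt (\<eta> t) * norm (w t - c)))\<^sup>2"
    using assms(2) by (intro power_mono) auto
  also have "\<dots> \<le> (\<Sum>t<T. (sqrt (\<eta> t))\<^sup>2) * (\<Sum>t<T. (sqrt (\<eta> t) * norm (w t - c))\<^sup>2)"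
    by (rule Cauchy_Schwarz_ineq_sum)
  also have "\<dots> = ?H * (\<Sum>t<T. \<eta> t * (norm (w t - c))\<^sup>2)"
    using assms(1) by (simp add: power_mult_distrib)
  finally show ?thesis
    using assms(2) by (simp add: power2_eq_square mult_ac mult_le_cancel_left_pos)
qed

text \<open>The epochs are analysed for an abstract operator. Strong monotonicity is stated between
  \<open>w\<close> and \<open>zs\<close>, with the vanishing term \<open>F zs\<close> left
  out.\<close>

locale lazy_newton =
  fixes F :: "'a::euclidean_space \<Rightarrow> 'a" and \<rho> \<mu> :: real and zs :: 'a
  assumes has_derivative: "\<And>z. (F has_derivative jacobian F z) (at z)"
    and jacobian_lipschitz:
      "\<And>z z' h. norm (jacobian F z h - jacobian F z' h) \<le> \<rho> * norm (z - z') * norm h"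
    and strongly_monotone: "\<And>w. \<mu> * (norm (w - zs))\<^sup>2 \<le> inner (F w) (w - zs)"
    and rho_pos: "\<rho> > 0" and mu_pos: "\<mu> > 0"
begin

lemma zero_unique: "F w = 0 \<Longrightarrow> w = zs"
  using strongly_monotone[of w] mu_pos by (simp add: mult_le_0_iff)

text \<open>By the half-step equation, \<open>\<gamma> *\<^sub>R (z' - w)\<close> is, up to sign,
  the error at \<open>w\<close> of the linear model of \<open>F\<close> at \<open>z\<close> with the
  stale Jacobian from \<open>p\<close>. With r the length of \<open>z - w\<close>, the Taylor
  remainder contributes \<rho> r^2 / 2 and the stale Jacobian \<rho> r times the drift; dividing by
  \<gamma> = 3 \<rho> m r cancels \<rho> and one r.\<close>

lemma extragradient_error:
  assumes "m > 0" and M: "M = 3 * \<rho> * real m"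
    and half: "F z = jacobian F p (z - w) + (M * norm (z - w)) *\<^sub>R (z - w)"
    and \<gamma>: "\<gamma> = M * norm (z - w)" "\<gamma> \<noteq> 0"
    and step: "z' = z - inverse \<gamma> *\<^sub>R F w"
  shows "(norm (z' - w))\<^sup>2 \<le> ((norm (z - w))\<^sup>2 / 2 + 2 * (norm (z - p))\<^sup>2) / (9 * (real m)\<^sup>2)"
proof -
  let ?r = "norm (z - w)"
  have r: "?r > 0" and M_pos: "M > 0"
    using \<gamma> M \<open>m > 0\<close> rho_pos by auto
  then have \<gamma>_pos: "\<gamma> > 0"
    using \<gamma> by simp
  have lin: "linear (jacobian F z)"
    using has_derivative by (rule has_derivative_linear)
  have "\<gamma> *\<^sub>R (z' - w) = F z - jacobian F p (z - w) - F w"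
  proof -
    have "\<gamma> *\<^sub>R (z' - w) = \<gamma> *\<^sub>R (z - w) - F w"
      using \<gamma>(2) by (simp add: step algebra_simps)
    then show ?thesis
      using half \<gamma>(1) by simp
  qed
  also have "\<dots> = - (F w - F z - jacobian F z (w - z)) + (jacobian F z (z - w) - jacobian F p (z - w))"
    using linear_diff[OF lin] by simp
  also have "norm \<dots> \<le> norm (F w - F z - jacobian F z (w - z))
      + norm (jacobian F z (z - w) - jacobian F p (z - w))"
    by (metis norm_minus_cancel norm_triangle_ineq)
  also have "\<dots> \<le> \<rho> / 2 * ?r\<^sup>2 + \<rho> * norm (z - p) * ?r"
    using taylor_lipschitz_derivative[OF has_derivative jacobian_lipschitz, of w z]
    by (intro add_mono jacobian_lipschitz) (simp add: norm_minus_commute)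
  finally have "M * ?r * norm (z' - w) \<le> \<rho> / 2 * ?r\<^sup>2 + \<rho> * norm (z - p) * ?r"
    using \<gamma>_pos \<gamma> by simp
  then have "(\<rho> * ?r) * (3 * real m * norm (z' - w)) \<le> (\<rho> * ?r) * (?r / 2 + norm (z - p))"
    by (simp add: M power2_eq_square algebra_simps)
  then have "3 * real m * norm (z' - w) \<le> ?r / 2 + norm (z - p)"
    using r rho_pos by simp
  then have "(3 * real m * norm (z' - w))\<^sup>2 \<le> (?r / 2 + norm (z - p))\<^sup>2"
    by (intro power_mono) auto
  also have "\<dots> \<le> ?r\<^sup>2 / 2 + 2 * (norm (z - p))\<^sup>2"
    using zero_le_power2[of "?r / 2 - norm (z - p)"] by (simp add: power2_eq_square field_simps)
  finally show ?thesis
    using \<open>m > 0\<close> by (simp add: power_mult_distrib field_simps)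
qed

text \<open>The drift is bounded by the steps, and these by half-step lengths and errors, so the
  error sum Q reappears on the right. With R the sum of the squared half-step lengths, dividing by
  m^2 leaves 9 Q \<le> R / 2 + 2 (R + Q), hence 7 Q \<le> 5 R / 2.\<close>

lemma sum_extragradient_error:
  fixes z w :: "nat \<Rightarrow> 'a" and \<gamma> :: "nat \<Rightarrow> real"
  assumes "m > 0" and M: "M = 3 * \<rho> * real m"
    and half: "\<And>t. t < T \<Longrightarrow> F (z t) = jacobian F (z (snapshot m t)) (z t - w t)
                     + (M * norm (z t - w t)) *\<^sub>R (z t - w t)"
    and \<gamma>: "\<And>t. t < T \<Longrightarrow> \<gamma> t = M * norm (z t - w t)" "\<And>t. t < T \<Longrightarrow> \<gamma> t \<noteq> 0"
    and step: "\<And>t. t < T \<Longrightarrow> z (Suc t) = z t - inverse (\<gamma> t) *\<^sub>R F (w t)"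
  shows "(\<Sum>t<T. (norm (z (Suc t) - w t))\<^sup>2) \<le> 5 / 14 * (\<Sum>t<T. (norm (z t - w t))\<^sup>2)"
proof -
  define r q D s where "r t = norm (z t - w t)" and "q t = norm (z (Suc t) - w t)"
    and "D t = norm (z t - z (snapshot m t))" and "s t = norm (z (Suc t) - z t)" for t
  have m2: "(real m)\<^sup>2 > 0"
    using \<open>m > 0\<close> by simp
  have s: "(s t)\<^sup>2 \<le> 2 * (r t)\<^sup>2 + 2 * (q t)\<^sup>2" for t
  proof -
    have "s t \<le> q t + r t"
      unfolding s_def q_def r_def by (metis dist_norm dist_triangle2 norm_minus_commute)
    then have "(s t)\<^sup>2 \<le> (q t + r t)\<^sup>2"
      by (intro power_mono) (auto simp: s_def)
    also have "\<dots> \<le> 2 * (r t)\<^sup>2 + 2 * (q t)\<^sup>2"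
      using zero_le_power2[of "q t - r t"] by (simp add: power2_eq_square algebra_simps)
    finally show ?thesis .
  qed
  have "(\<Sum>t<T. (D t)\<^sup>2) \<le> (real m)\<^sup>2 / 2 * (\<Sum>t<T. (s t)\<^sup>2)"
    unfolding D_def s_def by (rule sum_snapshot_dist_le[OF \<open>m > 0\<close>])
  also have "\<dots> \<le> (real m)\<^sup>2 / 2 * (\<Sum>t<T. 2 * (r t)\<^sup>2 + 2 * (q t)\<^sup>2)"
    using s by (intro mult_left_mono sum_mono) auto
  finally have D: "(\<Sum>t<T. (D t)\<^sup>2) \<le> (real m)\<^sup>2 * ((\<Sum>t<T. (r t)\<^sup>2) + (\<Sum>t<T. (q t)\<^sup>2))"
    by (simp add: sum.distrib distrib_left mult_ac flip: sum_distrib_left)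
  have "9 * (real m)\<^sup>2 * (q t)\<^sup>2 \<le> (real m)\<^sup>2 * (r t)\<^sup>2 / 2 + 2 * (D t)\<^sup>2" if "t < T" for t
  proof -
    have "(q t)\<^sup>2 \<le> ((r t)\<^sup>2 / 2 + 2 * (D t)\<^sup>2) / (9 * (real m)\<^sup>2)"
      unfolding q_def r_def D_def
      by (rule extragradient_error[OF \<open>m > 0\<close> M half \<gamma> step]) (use that in auto)
    then have "9 * (real m)\<^sup>2 * (q t)\<^sup>2 \<le> (r t)\<^sup>2 / 2 + 2 * (D t)\<^sup>2"
      using m2 by (simp add: field_simps)
    moreover have "(r t)\<^sup>2 \<le> (real m)\<^sup>2 * (r t)\<^sup>2"
      using \<open>m > 0\<close> by (simp add: mult_le_cancel_right1)
    ultimately show ?thesis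
      by linarith
  qed
  then have "(\<Sum>t<T. 9 * (real m)\<^sup>2 * (q t)\<^sup>2) \<le> (\<Sum>t<T. (real m)\<^sup>2 * (r t)\<^sup>2 / 2 + 2 * (D t)\<^sup>2)"
    by (intro sum_mono) auto
  then have "9 * (real m)\<^sup>2 * (\<Sum>t<T. (q t)\<^sup>2)
      \<le> (real m)\<^sup>2 * (\<Sum>t<T. (r t)\<^sup>2) / 2 + 2 * (\<Sum>t<T. (D t)\<^sup>2)"
    by (simp add: sum.distrib sum_distrib_left sum_divide_distrib)
  also have "\<dots> \<le> (real m)\<^sup>2 * (\<Sum>t<T. (r t)\<^sup>2) / 2
      + 2 * ((real m)\<^sup>2 * ((\<Sum>t<T. (r t)\<^sup>2) + (\<Sum>t<T. (q t)\<^sup>2)))"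
    using D by linarith
  finally have "(real m)\<^sup>2 * (7 * (\<Sum>t<T. (q t)\<^sup>2)) \<le> (real m)\<^sup>2 * (5 / 2 * (\<Sum>t<T. (r t)\<^sup>2))"
    by (simp add: algebra_simps)
  then show ?thesis
    using m2 unfolding q_def r_def by (simp only: mult_le_cancel_left_pos)
qed

text \<open>The distances to \<open>zs\<close> of the half steps and the lengths of the half steps share the budget
  \<open>(norm (z 0 - zs))\<^sup>2 / 2\<close>; bounding each of them by all of it separately would lose the constant
  \<open>8\<close> in \<open>LEN_contraction\<close>, which the accuracy after \<open>num_epochs \<epsilon>\<close> epochs needs.
  Any factor between \<open>8 / 27\<close> and \<open>9 / 28\<close> would do.\<close>

lemma energy_bound:
  fixes z w :: "nat \<Rightarrow> 'a" and \<gamma> :: "nat \<Rightarrow> real"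
  assumes "m > 0" and M: "M = 3 * \<rho> * real m"
    and half: "\<And>t. t < T \<Longrightarrow> F (z t) = jacobian F (z (snapshot m t)) (z t - w t)
                     + (M * norm (z t - w t)) *\<^sub>R (z t - w t)"
    and \<gamma>: "\<And>t. t < T \<Longrightarrow> \<gamma> t = M * norm (z t - w t)" "\<And>t. t < T \<Longrightarrow> \<gamma> t \<noteq> 0"
    and step: "\<And>t. t < T \<Longrightarrow> z (Suc t) = z t - inverse (\<gamma> t) *\<^sub>R F (w t)"
  shows "\<mu> * (\<Sum>t<T. inverse (\<gamma> t) * (norm (w t - zs))\<^sup>2) + 8 / 27 * (\<Sum>t<T. (norm (z t - w t))\<^sup>2)
    \<le> (norm (z 0 - zs))\<^sup>2 / 2"
proof -
  have M_pos: "M > 0"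
    using M \<open>m > 0\<close> rho_pos by auto
  have "\<mu> * (inverse (\<gamma> t) * (norm (w t - zs))\<^sup>2)
      \<le> ((norm (z t - zs))\<^sup>2 - (norm (z (Suc t) - zs))\<^sup>2) / 2
        + ((norm (z (Suc t) - w t))\<^sup>2 - (norm (z t - w t))\<^sup>2) / 2" if "t < T" for t
  proof -
    have "inverse (\<gamma> t) \<ge> 0"
      using \<gamma>(1)[OF that] M_pos by simp
    then have "inverse (\<gamma> t) * (\<mu> * (norm (w t - zs))\<^sup>2) \<le> inverse (\<gamma> t) * inner (F (w t)) (w t - zs)"
      by (intro mult_left_mono strongly_monotone)
    also have "\<dots> = inner (z t - z (Suc t)) (w t - zs)"
      by (simp add: step[OF that])
    \<comment> \<open>By polarization, the inner product splits into a part that telescopes over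
      \<open>t\<close> and a part that compares the two legs of the extragradient step.\<close>
    also have "\<dots> = ((norm (z t - zs))\<^sup>2 - (norm (z (Suc t) - zs))\<^sup>2) / 2
        + ((norm (z (Suc t) - w t))\<^sup>2 - (norm (z t - w t))\<^sup>2) / 2"
      by (simp add: power2_norm_eq_inner inner_diff_left inner_diff_right inner_commute field_simps)
    finally show ?thesis
      by (simp add: mult_ac)
  qed
  then have "(\<Sum>t<T. \<mu> * (inverse (\<gamma> t) * (norm (w t - zs))\<^sup>2))
      \<le> (\<Sum>t<T. ((norm (z t - zs))\<^sup>2 - (norm (z (Suc t) - zs))\<^sup>2) / 2
        + ((norm (z (Suc t) - w t))\<^sup>2 - (norm (z t - w t))\<^sup>2) / 2)"
    by (intro sum_mono) auto
  also have "\<dots> = ((norm (z 0 - zs))\<^sup>2 - (norm (z T - zs))\<^sup>2) / 2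
      + ((\<Sum>t<T. (norm (z (Suc t) - w t))\<^sup>2) - (\<Sum>t<T. (norm (z t - w t))\<^sup>2)) / 2"
    using sum_lessThan_telescope'[of "\<lambda>t. (norm (z t - zs))\<^sup>2" T]
    by (simp only: sum.distrib sum_subtractf flip: sum_divide_distrib)
  finally have "\<mu> * (\<Sum>t<T. inverse (\<gamma> t) * (norm (w t - zs))\<^sup>2)
      \<le> ((norm (z 0 - zs))\<^sup>2 - (norm (z T - zs))\<^sup>2) / 2
        + ((\<Sum>t<T. (norm (z (Suc t) - w t))\<^sup>2) - (\<Sum>t<T. (norm (z t - w t))\<^sup>2)) / 2"
    by (simp only: sum_distrib_left)
  moreover have "(norm (z T - zs))\<^sup>2 \<ge> 0"
    by simp
  \<comment> \<open>The squared half-step lengths now carry the coefficient (5/14 - 1) / 2 = - 9/28,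
    which is below - 8/27.\<close>
  moreover have "(\<Sum>t<T. (norm (z (Suc t) - w t))\<^sup>2) \<le> 5 / 14 * (\<Sum>t<T. (norm (z t - w t))\<^sup>2)"
    by (rule sum_extragradient_error[OF assms])
  moreover have "(\<Sum>t<T. (norm (z t - w t))\<^sup>2) \<ge> 0"
    by (intro sum_nonneg) auto
  ultimately show ?thesis
    by argo
qed

text \<open>\<open>R\<close> is the distance that fixes the epoch length, while \<open>z0\<close>
  starts the current epoch and may lie much closer to \<open>zs\<close>. Keeping the two apart gives
  a cubic bound, hence superlinear instead of linear decay.\<close>

lemma LEN_contraction:
  assumes "m > 0" and M: "M = 3 * \<rho> * real m"
    and "R > 0" and T: "(2 * M * R / \<mu>) powr (2 / 3) \<le> real T"
    and LEN: "LEN F z0 T m M out"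
  shows "8 * R * (norm (out - zs))\<^sup>2 \<le> (norm (z0 - zs))^3"
proof -
  have M_pos: "M > 0"
    using M \<open>m > 0\<close> rho_pos by auto
  define c where "c = 2 * M * R / \<mu>"
  have c: "c > 0"
    using M_pos mu_pos \<open>R > 0\<close> by (simp add: c_def)
  then have "T > 0"
    using T by (metis c_def less_numeral_extra(3) neq0_conv of_nat_0 order_less_le_trans powr_gt_zero)
  obtain z w \<gamma> where "z 0 = z0"
    and half: "\<And>t. t < T \<Longrightarrow> F (z t) = jacobian F (z (snapshot m t)) (z t - w t)
                     + (M * norm (z t - w t)) *\<^sub>R (z t - w t)"
    and \<gamma>: "\<And>t. t < T \<Longrightarrow> \<gamma> t = M * norm (z t - w t)"
    and step: "\<And>t. t < T \<Longrightarrow> z (Suc t) = z t - inverse (\<gamma> t) *\<^sub>R F (w t)"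
    and out: "if \<exists>t<T. \<gamma> t = 0 then \<exists>t<T. \<gamma> t = 0 \<and> out = z t
         else out = inverse (\<Sum>t<T. inverse (\<gamma> t)) *\<^sub>R (\<Sum>t<T. inverse (\<gamma> t) *\<^sub>R w t)"
  proof -
    have "T \<noteq> 0"
      using \<open>T > 0\<close> by simp
    then show thesis
      using LEN that unfolding LEN_def if_not_P[OF \<open>T \<noteq> 0\<close>] by (elim exE conjE) blast
  qed
  show ?thesis
  proof (cases "\<exists>t<T. \<gamma> t = 0")
    case True
    then obtain t where t: "t < T" "\<gamma> t = 0" "out = z t"
      using out by auto
    then have "z t - w t = 0"
      using \<gamma>[of t] M_pos by simp
    moreover have "jacobian F (z (snapshot m t)) 0 = 0"
      using has_derivative by (intro linear_0 has_derivative_linear)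
    ultimately have "F (z t) = 0"
      using half[OF t(1)] by simp
    then show ?thesis
      using t zero_unique by simp
  next
    case False
    then have \<gamma>0: "\<And>t. t < T \<Longrightarrow> \<gamma> t \<noteq> 0"
      by auto
    define r where "r t = norm (z t - w t)" for t
    define H B A E where "H = (\<Sum>t<T. inverse (r t))" and "B = sqrt (\<Sum>t<T. (r t)\<^sup>2)"
      and "A = \<mu> * (\<Sum>t<T. inverse (\<gamma> t) * (norm (w t - zs))\<^sup>2)"
      and "E = (norm (out - zs))\<^sup>2"
    define R' where "R' = norm (z0 - zs)"
    have r: "r t > 0" if "t < T" for t
      using \<gamma> \<gamma>0 that by (force simp: r_def)
    then have H: "H > 0"
      using \<open>T > 0\<close> unfolding H_def by (intro sum_pos) auto
    have B: "B \<ge> 0"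
      unfolding B_def by (intro real_sqrt_ge_zero sum_nonneg) auto
    have B2: "B\<^sup>2 = (\<Sum>t<T. (r t)\<^sup>2)"
      unfolding B_def by (intro real_sqrt_pow2 sum_nonneg) auto
    have sum_\<gamma>: "(\<Sum>t<T. inverse (\<gamma> t)) = H / M"
      using \<gamma> by (simp add: H_def r_def sum_divide_distrib inverse_eq_divide mult.commute)
    have energy: "A + 8 / 27 * B\<^sup>2 \<le> R'\<^sup>2 / 2"
      using energy_bound[OF \<open>m > 0\<close> M half \<gamma> \<gamma>0 step]
      by (simp add: A_def B2 r_def R'_def \<open>z 0 = z0\<close>)
    have "(\<Sum>t<T. inverse (\<gamma> t)) * E \<le> (\<Sum>t<T. inverse (\<gamma> t) * (norm (w t - zs))\<^sup>2)"
      using out False norm_weighted_mean_diff_le[of T "\<lambda>t. inverse (\<gamma> t)" w zs] \<gamma> M_pos H sum_\<gamma>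
      by (simp add: E_def)
    then have A: "\<mu> * (H * E / M) \<le> A"
      unfolding A_def using mu_pos by (intro mult_left_mono) (simp_all add: sum_\<gamma>)
    \<comment> \<open>The exponent 2/3 in the epoch length matches Hoelder's inequality: c^2 \<le>
      T^3 \<le> (H B)^2.\<close>
    have "c\<^sup>2 = (c powr (2 / 3)) ^ 3"
      using c by (simp add: powr_power)
    also have "\<dots> \<le> (real T) ^ 3"
      using T by (intro power_mono) (auto simp: c_def)
    also have "\<dots> \<le> (H * B)\<^sup>2"
      using card_cubed_le_sum_inverse[of T r] r by (simp add: power_mult_distrib B2 H_def)
    finally have "c \<le> H * B"
      using H B by (meson mult_nonneg_nonneg less_imp_le power2_le_imp_le)
    have "2 * R * E = \<mu> * (c * E / M)"
      using M_pos mu_pos by (simp add: c_def)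
    also have "\<dots> \<le> \<mu> * (H * B * E / M)"
      using \<open>c \<le> H * B\<close> M_pos mu_pos
      by (intro mult_left_mono divide_right_mono mult_right_mono) (auto simp: E_def)
    also have "\<dots> = \<mu> * (H * E / M) * B"
      by simp
    also have "\<dots> \<le> (R'\<^sup>2 / 2 - 8 / 27 * B\<^sup>2) * B"
      using A energy B by (intro mult_right_mono) auto
    also have "\<dots> \<le> R' ^ 3 / 4"
    proof -
      \<comment> \<open>For \<open>B\<close> \<ge> 0 the cubic (R'^2 / 2 - 8/27 B^2) B is largest at
        B = 3/4 R', where its value is R'^3 / 4; hence the double root there.\<close>
      have "R' ^ 3 / 4 - (R'\<^sup>2 / 2 - 8 / 27 * B\<^sup>2) * B = 8 / 27 * ((B - 3 / 4 * R')\<^sup>2 * (B + 3 / 2 * R'))"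
        by (simp add: power2_eq_square power3_eq_cube field_simps)
      moreover have "\<dots> \<ge> 0"
        using B by (simp add: R'_def)
      ultimately show ?thesis
        by linarith
    qed
    finally show ?thesis
      by (simp add: E_def R'_def)
  qed
qed

end

section \<open>Superlinear convergence of the restarts\<close>

text \<open>With u = e / (8 R) the recursion reads u(s+1)^2 \<le> u(s)^3, that is, u(s+1) \<le>
  u(s)^(3/2), starting from 1/8.\<close>

lemma superlinear_recursion:
  fixes e :: "nat \<Rightarrow> real"
  assumes "R > 0" "e 0 = R" "\<And>s. e s \<ge> 0"
    and rec: "\<And>s. s < S \<Longrightarrow> 8 * R * (e (Suc s))\<^sup>2 \<le> (e s)^3"
  shows "s \<le> S \<Longrightarrow> e s \<le> 8 * (1 / 8) powr ((3 / 2) ^ s) * R"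
proof (induction s)
  case (Suc s)
  define p :: real where "p = (3 / 2) ^ s"
  have "8 * R * (e (Suc s))\<^sup>2 \<le> (e s)^3"
    using Suc.prems by (intro rec) simp
  also have "\<dots> \<le> (8 * (1 / 8) powr p * R)^3"
    using Suc assms(3) by (intro power_mono) (auto simp: p_def)
  also have "\<dots> = 8 * R * (8 * (1 / 8) powr (3 / 2 * p) * R)\<^sup>2"
    by (simp add: power_mult_distrib power2_eq_square power3_eq_cube flip: powr_add)
  finally have "(e (Suc s))\<^sup>2 \<le> (8 * (1 / 8) powr (3 / 2 * p) * R)\<^sup>2"
    using \<open>R > 0\<close> by simp
  then show ?case
    using \<open>R > 0\<close> by (simp add: p_def power2_le_iff_abs_le)
qed (use assms in simp)

context lazy_newton
begin

text \<open>For \<open>s\<close> \<ge> 1 this is stronger than the squared rate with base 1/2. There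
  an exponent log_2 (1/\<epsilon>) would only give the square root of \<epsilon> times the initial
  distance; here it gives 8 \<epsilon>^3 times that distance.\<close>

lemma LEN_restart_rate:
  assumes "m > 0" and M: "M = 3 * \<rho> * real m"
    and T: "T = epoch_length \<rho> \<mu> m (norm (z0 - zs))"
    and Z: "LEN_restart F z0 T m M S Z" and "s \<le> S"
  shows "norm (Z s - zs) \<le> 8 * (1 / 8) powr ((3 / 2) ^ s) * norm (z0 - zs)"
proof (cases "z0 = zs")
  case True
  \<comment> \<open>The epoch length is 0 here, and an empty run returns its starting point.\<close>
  then have "T = 0"
    using T by (simp add: epoch_length_def)
  have "s \<le> S \<Longrightarrow> Z s = zs" for s
    using Z True by (induction s) (auto simp: LEN_restart_def LEN_def \<open>T = 0\<close>)
  with \<open>s \<le> S\<close> show ?thesis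
    by simp
next
  case False
  let ?R = "norm (z0 - zs)"
  have "(2 * M * ?R / \<mu>) powr (2 / 3) \<le> real T"
    unfolding T M epoch_length_def by (simp add: of_nat_ceiling)
  then have "8 * ?R * (norm (Z (Suc s) - zs))\<^sup>2 \<le> (norm (Z s - zs))^3" if "s < S" for s
    using Z that False by (intro LEN_contraction[OF \<open>m > 0\<close> M]) (auto simp: LEN_restart_def)
  moreover have "Z 0 = z0"
    using Z by (simp add: LEN_restart_def)
  ultimately show ?thesis
    using superlinear_recursion[of ?R "\<lambda>s. norm (Z s - zs)" S s] False \<open>s \<le> S\<close> by simp
qed

end

text \<open>With p = (3/2)^s, squaring gives the factor 64^(1 - p), which is at most 2^(-p) exactly
  when p \<ge> 6/5. The first epoch already has p = 3/2, whereas s = 0 has p = 1.\<close>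

lemma superlinear_rate_square:
  fixes e R :: real
  assumes "0 \<le> e" "e \<le> 8 * (1 / 8) powr ((3 / 2) ^ s) * R" "1 \<le> s"
  shows "e\<^sup>2 \<le> (1 / 2) powr ((3 / 2) ^ s) * R\<^sup>2"
proof -
  define p :: real where "p = (3 / 2) ^ s"
  have "p \<ge> (3 / 2) ^ 1"
    unfolding p_def using \<open>1 \<le> s\<close> by (intro power_increasing) auto
  then have "64 * (1 / 64) powr p = 2 powr (6 - 6 * p)"
    by (simp add: powr_diff powr_divide powr_powr[symmetric])
  also have "\<dots> \<le> 2 powr (- p)"
    using \<open>p \<ge> (3 / 2) ^ 1\<close> by simp
  also have "\<dots> = (1 / 2) powr p"
    by (simp add: powr_minus powr_divide inverse_eq_divide)
  finally have p: "64 * (1 / 64) powr p \<le> (1 / 2 :: real) powr p" .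
  have "((1 / 8 :: real) powr p)\<^sup>2 = (1 / 64) powr p"
    by (simp add: power2_eq_square flip: powr_mult)
  then have "(8 * (1 / 8) powr p * R)\<^sup>2 = 64 * (1 / 64) powr p * R\<^sup>2"
    by (simp add: power_mult_distrib)
  moreover have "e\<^sup>2 \<le> (8 * (1 / 8) powr p * R)\<^sup>2"
    using assms by (intro power_mono) (auto simp: p_def)
  moreover have "64 * (1 / 64) powr p * R\<^sup>2 \<le> (1 / 2) powr p * R\<^sup>2"
    using p by (intro mult_right_mono) auto
  ultimately show ?thesis
    by (simp add: p_def)
qed

text \<open>The epoch count makes the exponent at least log_2 (1/\<epsilon>), so e \<le> 8
  \<epsilon>^3 R. This suffices if R \<le> 1 / (4 \<epsilon>), and also if R \<le> 1 and
  \<epsilon>^2 \<le> 1/8. Larger \<epsilon> need the rounding of the epoch count.\<close>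

lemma num_epochs_accuracy:
  fixes e R \<epsilon> :: real
  assumes "0 \<le> e" "e \<le> 8 * (1 / 8) powr ((3 / 2) ^ num_epochs \<epsilon>) * R"
    and \<epsilon>: "0 < \<epsilon>" "\<epsilon> < 1 / 2" and R: "R \<le> max 1 (1 / (4 * \<epsilon>))"
  shows "e \<le> \<epsilon>"
proof -
  define p :: real where "p = (3 / 2) ^ num_epochs \<epsilon>"
  have L: "log 2 (1 / \<epsilon>) > 1"
    using \<epsilon> by (simp add: less_log_iff field_simps)
  then have L': "log (3 / 2) (log 2 (1 / \<epsilon>)) > 0"
    by simp
  have "R \<ge> 0"
  proof (rule ccontr)
    assume "\<not> R \<ge> 0"
    then have "8 * (1 / 8) powr ((3 / 2) ^ num_epochs \<epsilon>) * R < 0"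
      by (simp add: mult_pos_neg)
    then show False
      using assms(1,2) by linarith
  qed
  have "log 2 (1 / \<epsilon>) = (3 / 2) powr log (3 / 2) (log 2 (1 / \<epsilon>))"
    using L by simp
  also have "\<dots> \<le> (3 / 2) powr real (num_epochs \<epsilon>)"
    by (intro powr_mono) (auto simp: num_epochs_def of_nat_ceiling)
  also have "\<dots> = p"
    by (simp add: p_def powr_realpow)
  finally have "(1 / 8) powr p \<le> (1 / 8 :: real) powr log 2 (1 / \<epsilon>)"
    by (intro powr_mono') auto
  also have "\<dots> = ((1 / 2) powr log 2 (1 / \<epsilon>))^3"
    by (simp add: power3_eq_cube flip: powr_mult)
  also have "(1 / 2) powr log 2 (1 / \<epsilon>) = \<epsilon>"
    using \<epsilon> by (simp add: powr_divide)
  finally have "8 * (1 / 8) powr p * R \<le> 8 * \<epsilon>^3 * R"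
    using \<open>R \<ge> 0\<close> by (intro mult_right_mono) auto
  then have e: "e \<le> 8 * \<epsilon>^3 * R"
    using assms(2) by (simp add: p_def)
  consider "R \<le> 1 / (4 * \<epsilon>)" | "R \<le> 1" "\<epsilon>\<^sup>2 \<le> 1 / 8" | "R \<le> 1" "\<epsilon>\<^sup>2 > 1 / 8"
    using R by linarith
  then show ?thesis
  proof cases
    case 1
    then have "8 * \<epsilon>^3 * R \<le> 8 * \<epsilon>^3 * (1 / (4 * \<epsilon>))"
      using \<epsilon> by (intro mult_left_mono) auto
    also have "\<dots> = 2 * \<epsilon> * \<epsilon>"
      using \<epsilon> by (simp add: power3_eq_cube)
    also have "\<dots> \<le> 1 * \<epsilon>"
      using \<epsilon> by (intro mult_right_mono) auto
    finally show ?thesis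
      using e by simp
  next
    case 2
    have "8 * \<epsilon>^3 * R \<le> 8 * \<epsilon>^3 * 1"
      using 2 \<epsilon> by (intro mult_left_mono) auto
    also have "\<dots> = 8 * \<epsilon>\<^sup>2 * \<epsilon>"
      by (simp add: power2_eq_square power3_eq_cube)
    also have "\<dots> \<le> 1 * \<epsilon>"
      using 2 \<epsilon> by (intro mult_right_mono) auto
    finally show ?thesis
      using e by simp
  next
    case 3
    \<comment> \<open>As \<epsilon> < 1/2, the iterated logarithm is positive and rounds up to at
      least 1. One epoch gives the factor 8 * 8^(-3/2) = 8^(-1/2), which is less than \<epsilon> in
      this case.\<close>
    have "num_epochs \<epsilon> \<ge> 1"
      using L' unfolding num_epochs_def by linarith
    then have "p \<ge> (3 / 2) ^ 1"
      unfolding p_def by (intro power_increasing) auto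
    then have "(1 / 8) powr p \<le> (1 / 8 :: real) powr (3 / 2)"
      by (intro powr_mono') auto
    then have "e \<le> 8 * (1 / 8) powr (3 / 2) * 1"
      using assms(2) 3 \<open>R \<ge> 0\<close>
      by (intro order_trans[OF assms(2)] mult_mono) (auto simp: p_def)
    then have "e\<^sup>2 \<le> (8 * (1 / 8) powr (3 / 2))\<^sup>2"
      using assms(1) by (intro power_mono) auto
    also have "\<dots> = 1 / 8"
      by (simp add: power2_eq_square power3_eq_cube flip: powr_add)
    also have "\<dots> \<le> \<epsilon>\<^sup>2"
      using 3 by simp
    finally show ?thesis
      by (rule power2_le_imp_le) (use \<epsilon> in simp)
  qed
qed

section \<open>Complexity\<close>

text \<open>The principal filter makes the estimate uniform in the parameters: one constant and one
  range of \<open>x\<close> serve all \<open>p\<close> in \<open>A\<close>.\<close>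

lemma bigo_principal_prod:
  fixes h k :: "'a \<Rightarrow> real" and f g :: "'b \<Rightarrow> real"
  assumes "\<And>p. p \<in> A \<Longrightarrow> norm (h p) \<le> C * norm (k p)" "f \<in> O[F](g)"
  shows "(\<lambda>(p, x). h p * f x) \<in> O[principal A \<times>\<^sub>F F](\<lambda>(p, x). k p * g x)"
proof -
  obtain c where "c > 0" and c: "eventually (\<lambda>x. norm (f x) \<le> c * norm (g x)) F"
    using assms(2) by (rule landau_o.bigE)
  have "eventually (\<lambda>(p, x). norm (h p * f x) \<le> (C * c) * norm (k p * g x)) (principal A \<times>\<^sub>F F)"
    unfolding eventually_prod_filter
  proof (intro exI conjI allI impI)
    show "eventually (\<lambda>p. p \<in> A) (principal A)"
      by (simp add: eventually_principal)
    show "eventually (\<lambda>x. norm (f x) \<le> c * norm (g x)) F"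
      by (rule c)
    fix p x assume "p \<in> A" "norm (f x) \<le> c * norm (g x)"
    then have "norm (h p) * norm (f x) \<le> (C * norm (k p)) * (c * norm (g x))"
      by (intro mult_mono assms(1) order_trans[OF norm_ge_zero assms(1)]) auto
    then show "case (p, x) of (p, x) \<Rightarrow> norm (h p * f x) \<le> (C * c) * norm (k p * g x)"
      by (simp add: abs_mult mult_ac)
  qed
  then show ?thesis
    by (intro bigoI[of _ "C * c"]) (simp add: case_prod_unfold)
qed

lemma num_epochs_bigo: "(\<lambda>\<epsilon>. real (num_epochs \<epsilon>)) \<in> O[at_right 0](\<lambda>\<epsilon>. ln (ln (1 / \<epsilon>)))"
proof -
  \<comment> \<open>Near 0 the iterated logarithm is positive, so \<open>nat\<close> does not
    truncate and rounding up adds at most 1.\<close>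
  have "eventually (\<lambda>\<epsilon>::real. log (3 / 2) (log 2 (1 / \<epsilon>)) > 0) (at_right 0)"
    by real_asymp
  then have "eventually (\<lambda>\<epsilon>. norm (real (num_epochs \<epsilon>)) \<le> norm (log (3 / 2) (log 2 (1 / \<epsilon>)) + 1)) (at_right 0)"
  proof eventually_elim
    case (elim \<epsilon>)
    then have "real (num_epochs \<epsilon>) = real_of_int \<lceil>log (3 / 2) (log 2 (1 / \<epsilon>))\<rceil>"
      unfolding num_epochs_def by (intro of_nat_nat) simp
    then show ?case
      using elim ceiling_correct[of "log (3 / 2) (log 2 (1 / \<epsilon>))"] by simp
  qed
  then have "(\<lambda>\<epsilon>. real (num_epochs \<epsilon>)) \<in> O[at_right 0](\<lambda>\<epsilon>. log (3 / 2) (log 2 (1 / \<epsilon>)) + 1)"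
    by (rule landau_o.big_mono)
  also have "(\<lambda>\<epsilon>::real. log (3 / 2) (log 2 (1 / \<epsilon>)) + 1) \<in> O[at_right 0](\<lambda>\<epsilon>. ln (ln (1 / \<epsilon>)))"
    by real_asymp
  finally show ?thesis .
qed

lemma epoch_length_le:
  assumes "\<rho> > 0" "\<mu> > 0" "D \<ge> 0"
  shows "real (epoch_length \<rho> \<mu> m D)
    \<le> (6 * D) powr (2 / 3) * (real m powr (2 / 3) * (\<rho> / \<mu>) powr (2 / 3)) + 1"
proof -
  have "2 * (3 * \<rho> * real m) * D / \<mu> = 6 * D * (real m * (\<rho> / \<mu>))"
    by simp
  then have "epoch_length \<rho> \<mu> m D = nat \<lceil>(6 * D) powr (2 / 3) * (real m powr (2 / 3) * (\<rho> / \<mu>) powr (2 / 3))\<rceil>"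
    unfolding epoch_length_def using assms by (simp only: powr_mult)
  then show ?thesis
    using assms by simp
qed

lemma jacobian_calls_le:
  assumes "m > 0"
  shows "real (jacobian_calls m T) \<le> real T / real m + 1"
proof -
  \<comment> \<open>The index \<open>T div m\<close> is included to cover a last incomplete
    block.\<close>
  have "snapshot m ` {..<T} \<subseteq> (\<lambda>i. m * i) ` {..T div m}"
  proof (rule image_subsetI)
    fix t assume "t \<in> {..<T}"
    then have "t div m \<le> T div m"
      by (simp add: div_le_mono)
    moreover have "snapshot m t = m * (t div m)"
      by (simp add: snapshot_def minus_mod_eq_mult_div)
    ultimately show "snapshot m t \<in> (\<lambda>i. m * i) ` {..T div m}"
      by auto
  qed
  then have "jacobian_calls m T \<le> card {..T div m}"
    unfolding jacobian_calls_def by (meson card_image_le card_mono finite_atMost finite_imageI le_trans)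
  then have "real (jacobian_calls m T) \<le> real (T div m) + 1"
    by simp
  also have "\<dots> \<le> real T / real m + 1"
    by (simp add: of_nat_div_le_of_nat)
  finally show ?thesis .
qed

text \<open>Rounding the epoch length up may add 1; the lower bound \<open>\<kappa>0\<close> on
  \<rho> / \<mu> lets the main term absorb it.\<close>

lemma total_iterations_bigo:
  assumes "D \<ge> 0" "\<kappa>0 > 0"
  shows "(\<lambda>((m, \<rho>, \<mu>), \<epsilon>). real (epoch_length \<rho> \<mu> m D * num_epochs \<epsilon>))
          \<in> O[principal {(m :: nat, \<rho> :: real, \<mu> :: real). m \<ge> 1 \<and> \<rho> > 0 \<and> \<mu> > 0 \<and> \<rho> / \<mu> \<ge> \<kappa>0}
               \<times>\<^sub>F at_right (0 :: real)](
            \<lambda>((m, \<rho>, \<mu>), \<epsilon>). real m powr (2 / 3) * (\<rho> / \<mu>) powr (2 / 3) * ln (ln (1 / \<epsilon>)))"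
proof -
  define h where "h = (\<lambda>(m, \<rho>, \<mu>). real (epoch_length \<rho> \<mu> m D))"
  define k where "k = (\<lambda>(m :: nat, \<rho> :: real, \<mu>). real m powr (2 / 3) * (\<rho> / \<mu>) powr (2 / 3))"
  define C where "C = (6 * D) powr (2 / 3) + 1 / \<kappa>0 powr (2 / 3)"
  define A where "A = {(m :: nat, \<rho> :: real, \<mu> :: real). m \<ge> 1 \<and> \<rho> > 0 \<and> \<mu> > 0 \<and> \<rho> / \<mu> \<ge> \<kappa>0}"
  have "norm (h p) \<le> C * norm (k p)"
    if mem: "p \<in> A" for p
  proof -
    obtain m \<rho> \<mu> where p: "p = (m, \<rho>, \<mu>)" "m \<ge> 1" "\<rho> > 0" "\<mu> > 0" "\<rho> / \<mu> \<ge> \<kappa>0"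
      using mem by (auto simp: A_def)
    have "1 * \<kappa>0 powr (2 / 3) \<le> real m powr (2 / 3) * (\<rho> / \<mu>) powr (2 / 3)"
      using p assms by (intro mult_mono powr_mono2 ge_one_powr_ge_zero) auto
    then have "1 \<le> 1 / \<kappa>0 powr (2 / 3) * k p"
      using assms by (simp add: k_def p field_simps)
    moreover have "h p \<le> (6 * D) powr (2 / 3) * k p + 1"
      using epoch_length_le[of \<rho> \<mu> D m] p assms by (simp add: h_def k_def)
    ultimately have "h p \<le> C * k p"
      by (simp add: C_def distrib_right)
    then show ?thesis
      by (simp add: p h_def k_def)
  qed
  then have "(\<lambda>(p, \<epsilon>). h p * real (num_epochs \<epsilon>)) \<in> O[principal A \<times>\<^sub>F at_right 0](\<lambda>(p, \<epsilon>). k p * ln (ln (1 / \<epsilon>)))"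
    using num_epochs_bigo by (rule bigo_principal_prod)
  then show ?thesis
    by (simp add: A_def h_def k_def case_prod_unfold)
qed

text \<open>As \<open>ms d\<close> is comparable to \<open>d\<close>, the Jacobian calls of an epoch
  cost N d (T / m + 1) = O(N T + N d). The 1 from rounding T up is absorbed by N d, because d \<ge>
  1.\<close>

lemma oracle_cost_bigo:
  assumes "D \<ge> 0" and ms: "(\<lambda>d. real (ms d)) \<in> \<Theta>[principal {1..}](\<lambda>d. real d)"
  shows "(\<lambda>((N, d, \<rho>, \<mu>), \<epsilon>).
             oracle_cost N d (ms d) (epoch_length \<rho> \<mu> (ms d) D) (num_epochs \<epsilon>))
          \<in> O[principal {(N :: real, d :: nat, \<rho> :: real, \<mu> :: real). N > 0 \<and> d \<ge> 1 \<and> \<rho> > 0 \<and> \<mu> > 0}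
               \<times>\<^sub>F at_right (0 :: real)](
            \<lambda>((N, d, \<rho>, \<mu>), \<epsilon>).
               (N * real d + N * real d powr (2 / 3) * (\<rho> / \<mu>) powr (2 / 3)) * ln (ln (1 / \<epsilon>)))"
proof -
  obtain c1 where "c1 > 0" and c1: "\<And>d. d \<ge> 1 \<Longrightarrow> real (ms d) \<le> c1 * real d"
    using bigthetaD1[OF ms] by (elim landau_o.bigE) (auto simp: eventually_principal)
  obtain c2 where "c2 > 0" and c2: "\<And>d. d \<ge> 1 \<Longrightarrow> real (ms d) \<ge> c2 * real d"
    using bigthetaD2[OF ms] by (elim landau_omega.bigE) (auto simp: eventually_principal)
  define h where "h = (\<lambda>(N, d, \<rho>, \<mu>). N * real (F_calls (epoch_length \<rho> \<mu> (ms d) D))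
      + N * real d * real (jacobian_calls (ms d) (epoch_length \<rho> \<mu> (ms d) D)))"
  define k where "k = (\<lambda>(N, d :: nat, \<rho> :: real, \<mu>). N * real d + N * real d powr (2 / 3) * (\<rho> / \<mu>) powr (2 / 3))"
  \<comment> \<open>In units of N, each inner iteration pays for two evaluations of \<open>F\<close>
    and at most 1 / \<open>c2\<close> as its share of the Jacobians.\<close>
  define a where "a = 2 + 1 / c2"
  define b where "b = (6 * D) powr (2 / 3) * c1 powr (2 / 3)"
  have a: "a > 0" and b: "b \<ge> 0"
    using \<open>c2 > 0\<close> by (auto simp: a_def b_def add_pos_pos)
  define A where "A = {(N :: real, d :: nat, \<rho> :: real, \<mu> :: real). N > 0 \<and> d \<ge> 1 \<and> \<rho> > 0 \<and> \<mu> > 0}"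
  have "norm (h p) \<le> (a * b + a + 1) * norm (k p)"
    if mem: "p \<in> A" for p
  proof -
    obtain N d \<rho> \<mu> where p: "p = (N, d, \<rho>, \<mu>)" "N > 0" "d \<ge> 1" "\<rho> > 0" "\<mu> > 0"
      using mem by (auto simp: A_def)
    define T where "T = epoch_length \<rho> \<mu> (ms d) D"
    define x where "x = real d powr (2 / 3) * (\<rho> / \<mu>) powr (2 / 3)"
    have m: "real (ms d) \<ge> c2 * real d" "c2 * real d > 0"
      using c2 p \<open>c2 > 0\<close> by auto
    then have "ms d > 0"
      by (metis of_nat_0_less_iff order_less_le_trans)
    have "real T \<le> (6 * D) powr (2 / 3) * (real (ms d) powr (2 / 3) * (\<rho> / \<mu>) powr (2 / 3)) + 1"
      unfolding T_def using p assms by (intro epoch_length_le) auto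
    also have "\<dots> \<le> (6 * D) powr (2 / 3) * ((c1 * real d) powr (2 / 3) * (\<rho> / \<mu>) powr (2 / 3)) + 1"
      using c1 p by (intro add_right_mono mult_left_mono mult_right_mono powr_mono2) auto
    also have "\<dots> = b * x + 1"
      using \<open>c1 > 0\<close> by (simp add: b_def x_def powr_mult)
    finally have T: "real T \<le> b * x + 1" .
    have "real d * real (jacobian_calls (ms d) T) \<le> real d * (real T / real (ms d) + 1)"
      using jacobian_calls_le[OF \<open>ms d > 0\<close>] by (intro mult_left_mono) auto
    also have "\<dots> \<le> real d * (real T / (c2 * real d) + 1)"
      using m by (intro mult_left_mono add_right_mono divide_left_mono) auto
    also have "\<dots> = real T / c2 + real d"
      using p by (simp add: field_simps)
    finally have "2 * real T + real d * real (jacobian_calls (ms d) T) \<le> a * real T + real d"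
      by (simp add: a_def field_simps)
    also have "\<dots> \<le> a * (b * x + 1) + real d"
      using T a by simp
    also have "\<dots> \<le> (a * b + a + 1) * (real d + x)"
    proof -
      have "a * 1 \<le> a * real d"
        using a p by (intro mult_left_mono) auto
      moreover have "0 \<le> a * b * real d" "0 \<le> (a + 1) * x"
        using a b by (simp_all add: x_def)
      ultimately show ?thesis
        by (simp add: algebra_simps)
    qed
    finally have "N * (2 * real T + real d * real (jacobian_calls (ms d) T))
        \<le> N * ((a * b + a + 1) * (real d + x))"
      using p by simp
    then have "h p \<le> (a * b + a + 1) * k p"
      by (simp add: h_def k_def p F_calls_def x_def algebra_simps flip: T_def)
    moreover have "h p \<ge> 0" "k p \<ge> 0"
      using p by (simp_all add: h_def k_def)
    ultimately show ?thesis
      by simp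
  qed
  then have "(\<lambda>(p, \<epsilon>). h p * real (num_epochs \<epsilon>)) \<in> O[principal A \<times>\<^sub>F at_right 0](\<lambda>(p, \<epsilon>). k p * ln (ln (1 / \<epsilon>)))"
    using num_epochs_bigo by (rule bigo_principal_prod)
  then show ?thesis
    by (simp add: A_def h_def k_def case_prod_unfold oracle_cost_def mult.commute)
qed

text \<open>The rate starts at s = 1, since at s = 0 its right side is half of the squared initial
  distance. The epoch count does not depend on the initial distance, so the accuracy claim limits
  that distance in terms of \<epsilon>. The constants in the O-bounds may depend on
  \<open>D\<close>, \<open>\<kappa>0\<close> and \<open>ms\<close>, but are uniform in the remaining
  parameters.\<close>

theorem theorem4p2:
  fixes f :: "(real ^ 'dx) \<times> (real ^ 'dy) \<Rightarrow> real"
    and \<rho> \<mu> M :: real and m T :: nat and z0 zstar :: "(real ^ 'dx) \<times> (real ^ 'dy)"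
  assumes "\<rho> > 0" and "\<mu> > 0" and "m > 0"
    and "twice_cont_diff f" and "lipschitz_hessian \<rho> f"
    and "strongly_convex_concave \<mu> f"
    and "saddle_point f zstar"
    and "M = 3 * \<rho> * real m"
    and "T = epoch_length \<rho> \<mu> m (norm (z0 - zstar))"
  shows
    "(\<forall>z. saddle_point f z \<longrightarrow> z = zstar) \<and>
     (\<forall>S Z. LEN_restart (saddle_op f) z0 T m M S Z \<longrightarrow>
        (\<forall>s. 1 \<le> s \<and> s \<le> S \<longrightarrow>
           (norm (Z s - zstar))\<^sup>2 \<le> (1 / 2) powr ((3 / 2) ^ s) * (norm (z0 - zstar))\<^sup>2)) \<and>
     (\<forall>Z. (\<forall>S. LEN_restart (saddle_op f) z0 T m M S Z) \<longrightarrow> Z \<longlonglongrightarrow> zstar) \<and>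
     (\<forall>\<epsilon> Z. 0 < \<epsilon> \<and> \<epsilon> < 1 / 2 \<and> norm (z0 - zstar) \<le> max 1 (1 / (4 * \<epsilon>)) \<and>
        LEN_restart (saddle_op f) z0 T m M (num_epochs \<epsilon>) Z \<longrightarrow>
          norm (Z (num_epochs \<epsilon>) - zstar) \<le> \<epsilon>) \<and>
     (\<forall>D \<kappa>0 :: real. D \<ge> 0 \<and> \<kappa>0 > 0 \<longrightarrow>
        (\<lambda>((m, \<rho>, \<mu>), \<epsilon>). real (epoch_length \<rho> \<mu> m D * num_epochs \<epsilon>))
          \<in> O[principal {(m :: nat, \<rho> :: real, \<mu> :: real). m \<ge> 1 \<and> \<rho> > 0 \<and> \<mu> > 0 \<and> \<rho> / \<mu> \<ge> \<kappa>0}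
               \<times>\<^sub>F at_right (0 :: real)](
            \<lambda>((m, \<rho>, \<mu>), \<epsilon>). real m powr (2 / 3) * (\<rho> / \<mu>) powr (2 / 3) * ln (ln (1 / \<epsilon>)))) \<and>
     (\<forall>(D :: real) (ms :: nat \<Rightarrow> nat).
        D \<ge> 0 \<and> (\<lambda>d. real (ms d)) \<in> \<Theta>[principal {1..}](\<lambda>d. real d) \<longrightarrow>
        (\<lambda>((N, d, \<rho>, \<mu>), \<epsilon>).
             oracle_cost N d (ms d) (epoch_length \<rho> \<mu> (ms d) D) (num_epochs \<epsilon>))
          \<in> O[principal {(N :: real, d :: nat, \<rho> :: real, \<mu> :: real). N > 0 \<and> d \<ge> 1 \<and> \<rho> > 0 \<and> \<mu> > 0}
               \<times>\<^sub>F at_right (0 :: real)](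
            \<lambda>((N, d, \<rho>, \<mu>), \<epsilon>).
               (N * real d + N * real d powr (2 / 3) * (\<rho> / \<mu>) powr (2 / 3)) * ln (ln (1 / \<epsilon>))))"
proof -
  have diff: "\<And>z. f differentiable (at z)"
    using \<open>twice_cont_diff f\<close> unfolding twice_cont_diff_def by blast
  interpret lazy_newton "saddle_op f" \<rho> \<mu> zstar
  proof
    show "(saddle_op f has_derivative jacobian (saddle_op f) z) (at z)" for z
      using assms(4) by (simp add: jacobian_saddle_op has_derivative_saddle_op)
    show "norm (jacobian (saddle_op f) z h - jacobian (saddle_op f) z' h)
        \<le> \<rho> * norm (z - z') * norm h" for z z' h
      using assms(4,5) by (rule jacobian_saddle_op_lipschitz)
    show "\<mu> * (norm (w - zstar))\<^sup>2 \<le> inner (saddle_op f w) (w - zstar)" for w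
      using diff assms(6,7) by (rule saddle_op_strongly_monotone)
  qed (fact assms)+
  note rate = LEN_restart_rate[OF assms(3,8,9)]
  have "\<forall>z. saddle_point f z \<longrightarrow> z = zstar"
    using saddle_point_unique[OF diff assms(6,2)] assms(7) by blast
  moreover have "(norm (Z s - zstar))\<^sup>2 \<le> (1 / 2) powr ((3 / 2) ^ s) * (norm (z0 - zstar))\<^sup>2"
    if "LEN_restart (saddle_op f) z0 T m M S Z" "1 \<le> s \<and> s \<le> S" for S Z s
    using rate[OF that(1), of s] that(2) by (intro superlinear_rate_square) auto
  moreover have "Z \<longlonglongrightarrow> zstar" if "\<forall>S. LEN_restart (saddle_op f) z0 T m M S Z" for Z
  proof -
    have "(\<lambda>s. (1 / 8 :: real) powr ((3 / 2) ^ s)) \<longlonglongrightarrow> 0"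
      by real_asymp
    then have lim: "(\<lambda>s. 8 * (1 / 8) powr ((3 / 2) ^ s) * norm (z0 - zstar)) \<longlonglongrightarrow> 0"
      by (intro tendsto_mult_left_zero tendsto_mult_right_zero)
    have "norm (Z s - zstar) \<le> 8 * (1 / 8) powr ((3 / 2) ^ s) * norm (z0 - zstar)" for s
      using that by (intro rate[OF _ order_refl]) simp
    then have "(\<lambda>s. Z s - zstar) \<longlonglongrightarrow> 0"
      by (rule Lim_null_comparison[OF always_eventually[OF allI] lim])
    then show ?thesis
      by (rule LIM_zero_cancel)
  qed
  moreover have "norm (Z (num_epochs \<epsilon>) - zstar) \<le> \<epsilon>"
    if "0 < \<epsilon> \<and> \<epsilon> < 1 / 2 \<and> norm (z0 - zstar) \<le> max 1 (1 / (4 * \<epsilon>)) \<and>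
        LEN_restart (saddle_op f) z0 T m M (num_epochs \<epsilon>) Z" for \<epsilon> Z
    by (rule num_epochs_accuracy[OF norm_ge_zero rate[OF _ order_refl]]) (use that in simp_all)
  ultimately show ?thesis
    using total_iterations_bigo oracle_cost_bigo by (intro conjI allI impI) (simp_all del: split_paired_All)
qed

end
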